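(* Let $d\ge 1$, let $a^0,a^1\in\mathbb{R}^d$ have all entries strictly positive, and let $\mathcal{P}_0,\mathcal{P}_1\subset\mathbb{R}^d$ be the corresponding generalized cross polytopes, with associated polytope $\mathcal{D}\subset\mathbb{R}^{d+1}$. Let $r_i:=a^0_i/a^1_i$ for $i\in[d]$ and define the ratio set $R:=\{r_i:\ i\in[d]\}$. Then all vertical facets of $\mathcal{D}$ are described by optimal big-M lifting inequalities (starting from facet-describing inequalities of $\mathcal{P}_0$ or $\mathcal{P}_1$) if and only if $|R|\le 2$.
   Context: $[d]:=\{1,\dots,d\}$. For $k\in\{0,1\}$, the generalized cross polytope is $\mathcal{P}_k:=\{x\in\mathbb{R}^d:\ \sum_{i\in[d]}s_i a^k_i x_i\le 1\text{ for all }s\in\{\pm1\}^d\}$, equivalently $\{x:\sum_{i}a^k_i|x_i|\le1\}$. The polytope $\mathcal{D}$ is the convex hull in $\mathbb{R}^{d+1}$ (points written $(x,z_1)$ with $x\in\mathbb{R}^d$, $z_1\in\mathbb{R}$) of $(\mathcal{P}_0\times\{0\})\cup(\mathcal{P}_1\times\{1\})$. An inequality $\gamma^\top y\le\beta$ describes a facet of a polytope $\mathcal{Q}$ (is facet-describing for $\mathcal{Q}$) if it is satisfied by all points of $\mathcal{Q}$ and the face $\mathcal{Q}\cap\{y:\gamma^\top y=\beta\}$ has dimension $\dim\mathcal{Q}-1$. The inequalities $z_1\ge0$ and $z_1\le1$ describe facets of $\mathcal{D}$; all other facets of $\mathcal{D}$ are called vertical facets. Optimal big-M lifting: given an inequality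 $\alpha^\top x\le\beta$ and $k\in\{0,1\}$, let $M_k:=\min\{\beta-\alpha^\top x:\ x\in\mathcal{P}_k\}$. If $\alpha^\top x\le\beta$ is facet-describing for $\mathcal{P}_0$, its optimal big-M lifting inequality is $\alpha^\top x+M_1z_1\le\beta$. If $\alpha^\top x\le\beta$ is facet-describing for $\mathcal{P}_1$, its optimal big-M lifting inequality is $\alpha^\top x-M_0z_1\le\beta-M_0$. *)

theory Defs
  imports "HOL-Analysis.Analysis"
begin

definition gen_cross_polytope :: "real ^ 'n \<Rightarrow> (real ^ 'n) set" where
  "gen_cross_polytope a =
     {x. \<forall>s :: 'n \<Rightarrow> real. (\<forall>i. s i \<in> {-1, 1}) \<longrightarrow> (\<Sum>i\<in>UNIV. s i * (a $ i) * (x $ i)) \<le> 1}"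

definition disj_hull :: "real ^ 'n \<Rightarrow> real ^ 'n \<Rightarrow> ((real ^ 'n) \<times> real) set" where
  "disj_hull a0 a1 =
     convex hull (gen_cross_polytope a0 \<times> {0} \<union> gen_cross_polytope a1 \<times> {1})"

text \<open>A pair \<open>(\<gamma>, \<beta>)\<close> stands for the inequality \<open>\<gamma> \<bullet> y \<le> \<beta>\<close>.\<close>

definition facet_describing :: "'a::euclidean_space \<Rightarrow> real \<Rightarrow> 'a set \<Rightarrow> bool" where
  "facet_describing \<gamma> \<beta> Q \<longleftrightarrow>
     (\<forall>y\<in>Q. \<gamma> \<bullet> y \<le> \<beta>) \<and> aff_dim (Q \<inter> {y. \<gamma> \<bullet> y = \<beta>}) = aff_dim Q - 1"

definition describes_facet :: "'a::euclidean_space \<Rightarrow> real \<Rightarrow> 'a set \<Rightarrow> 'a set \<Rightarrow> bool" where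
  "describes_facet \<gamma> \<beta> Q F \<longleftrightarrow> facet_describing \<gamma> \<beta> Q \<and> F = Q \<inter> {y. \<gamma> \<bullet> y = \<beta>}"

definition vertical_facet ::
    "real ^ 'n \<Rightarrow> real ^ 'n \<Rightarrow> ((real ^ 'n) \<times> real) set \<Rightarrow> bool" where
  "vertical_facet a0 a1 F \<longleftrightarrow>
     F facet_of disj_hull a0 a1 \<and>
     F \<noteq> disj_hull a0 a1 \<inter> {y. snd y = 0} \<and>
     F \<noteq> disj_hull a0 a1 \<inter> {y. snd y = 1}"

text \<open>The minimum of \<open>\<beta> - \<alpha> \<bullet> x\<close> over \<open>P\<close>. It is only used for \<open>P = gen_cross_polytope a\<close>
  with \<open>a\<close> strictly positive; this set is compact and nonempty, so the minimum is attained.\<close>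

definition big_M :: "'a::euclidean_space set \<Rightarrow> 'a \<Rightarrow> real \<Rightarrow> real" where
  "big_M P \<alpha> \<beta> = (LEAST m. \<exists>x\<in>P. m = \<beta> - \<alpha> \<bullet> x)"

text \<open>The inner product on the product space is \<open>(\<alpha>, \<mu>) \<bullet> (x, z) = \<alpha> \<bullet> x + \<mu> * z\<close>.\<close>

inductive optimal_big_M_lifting ::
    "real ^ 'n \<Rightarrow> real ^ 'n \<Rightarrow> (real ^ 'n) \<times> real \<Rightarrow> real \<Rightarrow> bool"
  for a0 a1 :: "real ^ 'n" where
  from_0: "facet_describing \<alpha> \<beta> (gen_cross_polytope a0) \<Longrightarrow>
     M1 = big_M (gen_cross_polytope a1) \<alpha> \<beta> \<Longrightarrow>
     optimal_big_M_lifting a0 a1 (\<alpha>, M1) \<beta>"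
| from_1: "facet_describing \<alpha> \<beta> (gen_cross_polytope a1) \<Longrightarrow>
     M0 = big_M (gen_cross_polytope a0) \<alpha> \<beta> \<Longrightarrow>
     optimal_big_M_lifting a0 a1 (\<alpha>, - M0) (\<beta> - M0)"

end

theory Submission
  imports Defs
begin

text \<open>
  Write a valid inequality for the hull \<open>D\<close> as \<open>\<alpha> \<bullet> x + (\<beta> - \<beta>') z \<le> \<beta>\<close>. On the level \<open>z = 0\<close> it reads
  \<open>\<alpha> \<bullet> x \<le> \<beta>\<close> and on the level \<open>z = 1\<close> it reads \<open>\<alpha> \<bullet> x \<le> \<beta>'\<close>, so by testing axis points validity means
  \<open>|\<alpha>\<^sub>i| \<le> \<beta> a0\<^sub>i\<close> and \<open>|\<alpha>\<^sub>i| \<le> \<beta>' a1\<^sub>i\<close> for all \<open>i\<close>. A vertical facet is tight on both levels, and its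
  vertices are the axis points of those indices for which one of the two bounds is attained.

  The face spans enough dimensions exactly when every index attains one of the bounds and some index
  \<open>j\<close> attains both: a missing index would put the face into \<open>x\<^sub>i = 0\<close>, and without a shared index the
  contributions of the two levels could be separated by a second linear equation
  (\<open>vertical_facetE\<close> and, conversely, \<open>facet_describing_disj_hull\<close>). Hence, up to scaling and signs,
  vertical facets correspond to the ratios \<open>t = \<beta>' / \<beta> = r\<^sub>j\<close>, with normal
  \<open>|\<alpha>\<^sub>i| = min (a0\<^sub>i, t a1\<^sub>i)\<close>.

  The facets of the two cross polytopes have normals proportional to \<open>a0\<close> and \<open>a1\<close> up to signs
  (\<open>facet_describing_gen_cross_polytope_iff\<close>). The normal \<open>min (a0\<^sub>i, t a1\<^sub>i)\<close> is of the first kind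
  if \<open>t\<close> is the largest ratio and of the second kind if \<open>t\<close> is the smallest, and the big-M coefficient
  then is the one forced by tightness on the other level. For a ratio strictly between two others it is
  of neither kind. So all vertical facets are liftings if and only if no ratio lies strictly
  between two others, that is, if there are at most two ratios.
\<close>

section \<open>Hyperplane sections of codimension one\<close>

lemma dim_full_iff_no_annihilator:
  fixes F :: "'a::euclidean_space set"
  shows "dim F = DIM('a) \<longleftrightarrow> (\<forall>\<delta>. (\<forall>y\<in>F. \<delta> \<bullet> y = 0) \<longrightarrow> \<delta> = 0)"
proof
  assume d: "dim F = DIM('a)"
  show "\<forall>\<delta>. (\<forall>y\<in>F. \<delta> \<bullet> y = 0) \<longrightarrow> \<delta> = 0"
  proof (intro allI impI, rule ccontr)
    fix \<delta> :: 'a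
    assume "\<forall>y\<in>F. \<delta> \<bullet> y = 0" and "\<delta> \<noteq> 0"
    then have "dim F \<le> dim {x. \<delta> \<bullet> x = 0}"
      by (intro dim_subset) auto
    with \<open>\<delta> \<noteq> 0\<close> d show False
      by (simp add: dim_hyperplane) (metis DIM_positive Suc_pred not_less_eq_eq order_refl)
  qed
next
  assume *: "\<forall>\<delta>. (\<forall>y\<in>F. \<delta> \<bullet> y = 0) \<longrightarrow> \<delta> = 0"
  show "dim F = DIM('a)"
  proof (rule ccontr)
    assume "dim F \<noteq> DIM('a)"
    then have "dim F < DIM('a)"
      using dim_subset_UNIV[of F] by linarith
    then obtain a :: 'a where "a \<noteq> 0" "span F \<subseteq> {x. a \<bullet> x = 0}"
      using lowdim_subset_hyperplane by blast
    with * span_superset[of F] show False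
      by blast
  qed
qed

lemma aff_dim_full_of_no_annihilator:
  fixes Q :: "'a::euclidean_space set"
  assumes "0 \<in> Q" and "F \<subseteq> Q" and "\<And>\<delta>. (\<forall>y\<in>F. \<delta> \<bullet> y = 0) \<Longrightarrow> \<delta> = 0"
  shows "aff_dim Q = DIM('a)"
proof -
  have "dim Q = DIM('a)"
    unfolding dim_full_iff_no_annihilator using assms(2,3) by blast
  then show ?thesis
    by (simp add: aff_dim_zero hull_inc assms(1))
qed

text \<open>A set in a hyperplane that misses the origin loses nothing when passing to its linear span:
  adding the origin raises the affine dimension by exactly one. This turns every dimension count
  for a face into the question whether a linear functional can vanish on that face.\<close>

lemma aff_dim_hyperplane_section_iff:
  fixes F :: "'a::euclidean_space set"
  assumes "F \<subseteq> {y. \<gamma> \<bullet> y = \<beta>}" and "\<beta> \<noteq> 0"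
  shows "aff_dim F = DIM('a) - 1 \<longleftrightarrow> (\<forall>\<delta>. (\<forall>y\<in>F. \<delta> \<bullet> y = 0) \<longrightarrow> \<delta> = 0)"
proof -
  have "affine hull F \<subseteq> {y. \<gamma> \<bullet> y = \<beta>}"
    using assms(1) by (rule hull_minimal) (rule affine_hyperplane)
  then have "0 \<notin> affine hull F"
    using assms(2) by auto
  then have "aff_dim F + 1 = aff_dim (insert 0 F)"
    by (simp add: aff_dim_insert)
  also have "\<dots> = dim (insert 0 F)"
    by (simp add: aff_dim_zero hull_inc)
  also have "dim (insert 0 F) = dim F"
    by (metis dim_span span_insert_0)
  finally have "aff_dim F = int (dim F) - 1"
    by simp
  then show ?thesis
    using DIM_positive[where 'a='a]
    unfolding dim_full_iff_no_annihilator[symmetric] by auto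
qed

section \<open>Generalized cross polytopes\<close>

lemma mem_gen_cross_polytope_iff:
  fixes a :: "real ^ 'n"
  assumes "\<And>i. a $ i > 0"
  shows "x \<in> gen_cross_polytope a \<longleftrightarrow> (\<Sum>i\<in>UNIV. a $ i * \<bar>x $ i\<bar>) \<le> 1"
proof
  assume x: "x \<in> gen_cross_polytope a"
  let ?s = "\<lambda>i. if x $ i \<ge> 0 then 1 else - 1 :: real"
  have "(\<Sum>i\<in>UNIV. ?s i * a $ i * x $ i) \<le> 1"
    using x unfolding gen_cross_polytope_def by force
  moreover have "(\<Sum>i\<in>UNIV. ?s i * a $ i * x $ i) = (\<Sum>i\<in>UNIV. a $ i * \<bar>x $ i\<bar>)"
    by (rule sum.cong) auto
  ultimately show "(\<Sum>i\<in>UNIV. a $ i * \<bar>x $ i\<bar>) \<le> 1"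
    by simp
next
  assume x: "(\<Sum>i\<in>UNIV. a $ i * \<bar>x $ i\<bar>) \<le> 1"
  have "(\<Sum>i\<in>UNIV. s i * a $ i * x $ i) \<le> 1" if s: "\<forall>i. s i \<in> {- 1, 1}" for s
  proof -
    have "s i * a $ i * x $ i \<le> a $ i * \<bar>x $ i\<bar>" for i
    proof -
      have "s i = - 1 \<or> s i = 1"
        using s by auto
      moreover have "a $ i * x $ i \<le> a $ i * \<bar>x $ i\<bar>" "a $ i * - (x $ i) \<le> a $ i * \<bar>x $ i\<bar>"
        using assms[of i] by (intro mult_left_mono; simp)+
      ultimately show ?thesis
        by auto
    qed
    then have "(\<Sum>i\<in>UNIV. s i * a $ i * x $ i) \<le> (\<Sum>i\<in>UNIV. a $ i * \<bar>x $ i\<bar>)"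
      by (intro sum_mono)
    with x show ?thesis
      by linarith
  qed
  then show "x \<in> gen_cross_polytope a"
    unfolding gen_cross_polytope_def by blast
qed

lemma sum_mult_axis:
  fixes f :: "'n::finite \<Rightarrow> real"
  shows "(\<Sum>j\<in>UNIV. f j * \<bar>axis i c $ j\<bar>) = f i * \<bar>c\<bar>"
proof -
  have "(\<Sum>j\<in>UNIV. f j * \<bar>axis i c $ j\<bar>) = (\<Sum>j\<in>UNIV. if j = i then f i * \<bar>c\<bar> else 0)"
    by (rule sum.cong) (auto simp: axis_def)
  then show ?thesis
    by simp
qed

lemma axis_in_gen_cross_polytope:
  fixes a :: "real ^ 'n"
  assumes "\<And>i. a $ i > 0" and "\<bar>c\<bar> \<le> 1"
  shows "axis i (c / a $ i) \<in> gen_cross_polytope a"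
  using assms(1)[of i] assms(2)
  by (simp add: mem_gen_cross_polytope_iff[OF assms(1)] sum_mult_axis abs_divide)

lemma zero_in_gen_cross_polytope:
  fixes a :: "real ^ 'n"
  assumes "\<And>i. a $ i > 0"
  shows "0 \<in> gen_cross_polytope a"
  by (simp add: mem_gen_cross_polytope_iff[OF assms])

text \<open>For a valid inequality all terms of the sum are nonnegative. The bound then gives validity
  from the conditions on the coefficients, and at a tight point it makes every term vanish.\<close>

lemma sum_coordinate_slacks_le:
  fixes a :: "real ^ 'n"
  assumes "\<And>i. a $ i > 0" and "\<beta> \<ge> 0" and "x \<in> gen_cross_polytope a"
  shows "(\<Sum>i\<in>UNIV. (\<beta> * a $ i - \<bar>\<alpha> $ i\<bar>) * \<bar>x $ i\<bar>) \<le> \<beta> - \<alpha> \<bullet> x"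
proof -
  have "\<alpha> \<bullet> x \<le> (\<Sum>i\<in>UNIV. \<bar>\<alpha> $ i\<bar> * \<bar>x $ i\<bar>)"
    by (auto simp: inner_vec_def abs_mult[symmetric] intro!: sum_mono)
  moreover have "\<beta> * (\<Sum>i\<in>UNIV. a $ i * \<bar>x $ i\<bar>) \<le> \<beta>"
    using assms by (simp add: mem_gen_cross_polytope_iff[OF assms(1)] mult_left_le)
  ultimately show ?thesis
    by (simp add: left_diff_distrib sum_subtractf sum_distrib_left mult.assoc)
qed

lemma valid_gen_cross_polytope_iff:
  fixes a :: "real ^ 'n"
  assumes a: "\<And>i. a $ i > 0"
  shows "(\<forall>x\<in>gen_cross_polytope a. \<alpha> \<bullet> x \<le> \<beta>) \<longleftrightarrow> (\<forall>i. \<bar>\<alpha> $ i\<bar> \<le> \<beta> * a $ i)"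
proof
  assume *: "\<forall>x\<in>gen_cross_polytope a. \<alpha> \<bullet> x \<le> \<beta>"
  show "\<forall>i. \<bar>\<alpha> $ i\<bar> \<le> \<beta> * a $ i"
  proof
    fix i
    have "\<alpha> \<bullet> axis i (c / a $ i) \<le> \<beta>" if "c \<in> {- 1, 1}" for c
      using * axis_in_gen_cross_polytope[OF a, of c i] that by auto
    from this[of 1] this[of "- 1"] show "\<bar>\<alpha> $ i\<bar> \<le> \<beta> * a $ i"
      using a[of i] by (simp add: inner_axis field_simps abs_le_iff)
  qed
next
  assume *: "\<forall>i. \<bar>\<alpha> $ i\<bar> \<le> \<beta> * a $ i"
  have "0 \<le> \<beta> * a $ undefined"
    using * abs_ge_zero order_trans by blast
  then have "\<beta> \<ge> 0"
    using a[of undefined] by (simp add: zero_le_mult_iff)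
  show "\<forall>x\<in>gen_cross_polytope a. \<alpha> \<bullet> x \<le> \<beta>"
  proof
    fix x
    assume "x \<in> gen_cross_polytope a"
    with sum_coordinate_slacks_le[OF a \<open>\<beta> \<ge> 0\<close>]
    have "(\<Sum>i\<in>UNIV. (\<beta> * a $ i - \<bar>\<alpha> $ i\<bar>) * \<bar>x $ i\<bar>) \<le> \<beta> - \<alpha> \<bullet> x" .
    moreover have "0 \<le> (\<Sum>i\<in>UNIV. (\<beta> * a $ i - \<bar>\<alpha> $ i\<bar>) * \<bar>x $ i\<bar>)"
      using * by (intro sum_nonneg) auto
    ultimately show "\<alpha> \<bullet> x \<le> \<beta>"
      by linarith
  qed
qed

lemma tight_point_coordinate_zero:
  fixes a :: "real ^ 'n"
  assumes a: "\<And>i. a $ i > 0" and \<alpha>: "\<And>i. \<bar>\<alpha> $ i\<bar> \<le> \<beta> * a $ i"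
    and x: "x \<in> gen_cross_polytope a" "\<alpha> \<bullet> x = \<beta>" and k: "\<bar>\<alpha> $ k\<bar> < \<beta> * a $ k"
  shows "x $ k = 0"
proof (rule ccontr)
  assume "x $ k \<noteq> 0"
  have "0 < \<beta> * a $ k"
    using k abs_ge_zero le_less_trans by blast
  then have "\<beta> \<ge> 0"
    using a[of k] by (simp add: zero_less_mult_iff)
  have "0 < (\<Sum>i\<in>UNIV. (\<beta> * a $ i - \<bar>\<alpha> $ i\<bar>) * \<bar>x $ i\<bar>)"
    using \<alpha> k \<open>x $ k \<noteq> 0\<close> by (intro sum_pos2[of _ k]) auto
  with sum_coordinate_slacks_le[OF a \<open>\<beta> \<ge> 0\<close> x(1), of \<alpha>] x(2) show False
    by simp
qed

text \<open>A strict inequality \<open>|\<alpha>\<^sub>i| < \<beta> a\<^sub>i\<close> would confine the face to the coordinate hyperplane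
  \<open>x\<^sub>i = 0\<close>, whereas a facet off the origin spans the space. If all are equalities, the axis points
  with the signs of \<open>\<alpha>\<close> are tight and span.\<close>

lemma facet_describing_gen_cross_polytope_iff:
  fixes a :: "real ^ 'n"
  assumes a: "\<And>i. a $ i > 0"
  shows "facet_describing \<alpha> \<beta> (gen_cross_polytope a) \<longleftrightarrow> 0 < \<beta> \<and> (\<forall>i. \<bar>\<alpha> $ i\<bar> = \<beta> * a $ i)"
proof -
  let ?P = "gen_cross_polytope a"
  let ?F = "?P \<inter> {y. \<alpha> \<bullet> y = \<beta>}"
  have "aff_dim ?P = DIM(real ^ 'n)"
  proof (rule aff_dim_full_of_no_annihilator[OF zero_in_gen_cross_polytope[OF a]])
    fix \<delta> :: "real ^ 'n"
    assume *: "\<forall>y\<in>?P. \<delta> \<bullet> y = 0"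
    have "\<delta> \<bullet> axis i (1 / a $ i) = 0" for i
      using * axis_in_gen_cross_polytope[OF a, of 1 i] by auto
    then show "\<delta> = 0"
      using a by (auto simp: inner_axis vec_eq_iff dest: less_imp_neq[symmetric])
  qed simp
  then have dim: "aff_dim ?P = CARD('n)"
    by simp
  show ?thesis
  proof
    assume "facet_describing \<alpha> \<beta> ?P"
    then have valid: "\<forall>y\<in>?P. \<alpha> \<bullet> y \<le> \<beta>" and F: "aff_dim ?F = aff_dim ?P - 1"
      by (auto simp: facet_describing_def)
    then have le: "\<bar>\<alpha> $ i\<bar> \<le> \<beta> * a $ i" for i
      using valid_gen_cross_polytope_iff[OF a] by blast
    have "\<beta> \<ge> 0"
      using valid zero_in_gen_cross_polytope[OF a] by force
    have "\<beta> \<noteq> 0"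
    proof
      assume "\<beta> = 0"
      with le have "\<alpha> = 0"
        by (simp add: vec_eq_iff)
      with \<open>\<beta> = 0\<close> F show False
        by simp
    qed
    have "\<bar>\<alpha> $ i\<bar> = \<beta> * a $ i" for i
    proof (rule ccontr)
      assume "\<bar>\<alpha> $ i\<bar> \<noteq> \<beta> * a $ i"
      with le[of i] have "\<bar>\<alpha> $ i\<bar> < \<beta> * a $ i"
        by simp
      then have "\<forall>y\<in>?F. axis i 1 \<bullet> y = 0"
        using tight_point_coordinate_zero[OF a le] by (auto simp: inner_axis')
      moreover have "\<forall>\<delta>. (\<forall>y\<in>?F. \<delta> \<bullet> y = 0) \<longrightarrow> \<delta> = 0"
        using F dim \<open>\<beta> \<noteq> 0\<close> aff_dim_hyperplane_section_iff[of ?F \<alpha> \<beta>] by simp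
      ultimately have "axis i (1::real) = 0"
        by blast
      then show False
        by simp
    qed
    with \<open>\<beta> \<ge> 0\<close> \<open>\<beta> \<noteq> 0\<close> show "0 < \<beta> \<and> (\<forall>i. \<bar>\<alpha> $ i\<bar> = \<beta> * a $ i)"
      by simp
  next
    assume *: "0 < \<beta> \<and> (\<forall>i. \<bar>\<alpha> $ i\<bar> = \<beta> * a $ i)"
    have "\<delta> = 0" if \<delta>: "\<forall>y\<in>?F. \<delta> \<bullet> y = 0" for \<delta> :: "real ^ 'n"
    proof -
      have "\<delta> $ i = 0" for i
      proof -
        have "\<alpha> $ i \<noteq> 0"
          using * a[of i] by (metis abs_zero less_irrefl mult_pos_pos)
        moreover have "\<alpha> $ i * sgn (\<alpha> $ i) = \<beta> * a $ i"
          using * by (simp add: abs_sgn[symmetric])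
        ultimately have "axis i (sgn (\<alpha> $ i) / a $ i) \<in> ?F"
          using a[of i] by (auto intro!: axis_in_gen_cross_polytope[OF a] simp: inner_axis abs_sgn_eq)
        then have "\<delta> \<bullet> axis i (sgn (\<alpha> $ i) / a $ i) = 0"
          using \<delta> by blast
        then show ?thesis
          using \<open>\<alpha> $ i \<noteq> 0\<close> a[of i] by (auto simp: inner_axis sgn_zero_iff)
      qed
      then show ?thesis
        by (simp add: vec_eq_iff)
    qed
    then have "aff_dim ?F = aff_dim ?P - 1"
      using * dim aff_dim_hyperplane_section_iff[of ?F \<alpha> \<beta>] by simp
    moreover have "\<forall>y\<in>?P. \<alpha> \<bullet> y \<le> \<beta>"
      using * valid_gen_cross_polytope_iff[OF a] by auto
    ultimately show "facet_describing \<alpha> \<beta> ?P"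
      by (simp add: facet_describing_def)
  qed
qed

lemma polytope_gen_cross_polytope:
  fixes a :: "real ^ 'n"
  assumes a: "\<And>i. a $ i > 0"
  shows "polytope (gen_cross_polytope a)"
proof -
  let ?S = "{s :: 'n \<Rightarrow> real. \<forall>i. s i \<in> {- 1, 1}}"
  let ?h = "\<lambda>s :: 'n \<Rightarrow> real. {x. (\<chi> i. s i * a $ i) \<bullet> x \<le> 1}"
  have "finite ?S"
    using finite_set_of_finite_funs[of "UNIV :: 'n set" "{- 1, 1 :: real}" 0] by simp
  then have "polyhedron (\<Inter>(?h ` ?S))"
    by (intro polyhedron_Inter) (auto intro: polyhedron_halfspace_le)
  moreover have "gen_cross_polytope a = \<Inter>(?h ` ?S)"
    by (auto simp: gen_cross_polytope_def inner_vec_def)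
  moreover have "bounded (gen_cross_polytope a)"
  proof -
    have "\<bar>x $ i\<bar> \<le> (\<Sum>j\<in>UNIV. 1 / a $ j)" if "x \<in> gen_cross_polytope a" for x i
    proof -
      have "a $ i * \<bar>x $ i\<bar> \<le> (\<Sum>j\<in>UNIV. a $ j * \<bar>x $ j\<bar>)"
        using a by (intro member_le_sum) (auto simp: less_imp_le)
      also have "\<dots> \<le> 1"
        using that mem_gen_cross_polytope_iff[OF a] by blast
      finally have "\<bar>x $ i\<bar> \<le> 1 / a $ i"
        using a[of i] by (simp add: field_simps)
      also have "\<dots> \<le> (\<Sum>j\<in>UNIV. 1 / a $ j)"
        using a by (intro member_le_sum) (auto simp: less_imp_le)
      finally show ?thesis .
    qed
    then have "\<forall>x\<in>gen_cross_polytope a. norm x \<le> (\<Sum>i\<in>(UNIV :: 'n set). \<Sum>j\<in>UNIV. 1 / a $ j)"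
      by (intro ballI order_trans[OF norm_le_l1_cart] sum_mono) auto
    then show ?thesis
      unfolding bounded_iff by blast
  qed
  ultimately show ?thesis
    by (simp add: polytope_eq_bounded_polyhedron)
qed

lemma big_M_eq:
  assumes "\<And>x. x \<in> P \<Longrightarrow> \<alpha> \<bullet> x \<le> h" and "x0 \<in> P" and "\<alpha> \<bullet> x0 = h"
  shows "big_M P \<alpha> \<beta> = \<beta> - h"
  unfolding big_M_def by (rule Least_equality) (use assms in force)+

section \<open>The convex hull of the two stacked polytopes\<close>

lemma polytope_disj_hull:
  fixes a0 a1 :: "real ^ 'n"
  assumes "\<And>i. a0 $ i > 0" and "\<And>i. a1 $ i > 0"
  shows "polytope (disj_hull a0 a1)"
proof -
  obtain V where V: "finite V" "gen_cross_polytope a0 \<times> {0::real} = convex hull V"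
    using polytope_Times[OF polytope_gen_cross_polytope[OF assms(1)] polytope_sing]
    unfolding polytope_def by blast
  obtain W where W: "finite W" "gen_cross_polytope a1 \<times> {1::real} = convex hull W"
    using polytope_Times[OF polytope_gen_cross_polytope[OF assms(2)] polytope_sing]
    unfolding polytope_def by blast
  have "disj_hull a0 a1 = convex hull (V \<union> W)"
    unfolding disj_hull_def V W by (metis hull_Un_left hull_Un_right)
  then show ?thesis
    using V(1) W(1) by (simp add: polytope_convex_hull)
qed

lemma mem_disj_hullI:
  "x \<in> gen_cross_polytope a0 \<Longrightarrow> (x, 0) \<in> disj_hull a0 a1"
  "x \<in> gen_cross_polytope a1 \<Longrightarrow> (x, 1) \<in> disj_hull a0 a1"
  unfolding disj_hull_def by (auto intro!: hull_inc)

lemma mem_disj_hullE: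
  fixes a0 a1 :: "real ^ 'n"
  assumes "\<And>i. a0 $ i > 0" and "\<And>i. a1 $ i > 0" and "y \<in> disj_hull a0 a1"
  obtains x0 x1 z where "x0 \<in> gen_cross_polytope a0" "x1 \<in> gen_cross_polytope a1"
    "0 \<le> z" "z \<le> 1" "y = ((1 - z) *\<^sub>R x0 + z *\<^sub>R x1, z)"
proof -
  have "convex (gen_cross_polytope a0 \<times> {0::real})" "convex (gen_cross_polytope a1 \<times> {1::real})"
    using polytope_gen_cross_polytope[OF assms(1)] polytope_gen_cross_polytope[OF assms(2)]
    by (auto intro!: convex_Times intro: polytope_imp_convex)
  moreover have "gen_cross_polytope a0 \<noteq> {}" "gen_cross_polytope a1 \<noteq> {}"
    using zero_in_gen_cross_polytope[OF assms(1)] zero_in_gen_cross_polytope[OF assms(2)] by auto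
  ultimately have "disj_hull a0 a1 = {u *\<^sub>R s + v *\<^sub>R t | u v s t. u \<ge> 0 \<and> v \<ge> 0 \<and> u + v = 1 \<and>
      s \<in> gen_cross_polytope a0 \<times> {0} \<and> t \<in> gen_cross_polytope a1 \<times> {1}}"
    unfolding disj_hull_def by (intro convex_hull_union_two) auto
  then obtain u v s t where uv: "u \<ge> 0" "v \<ge> 0" "u + v = 1"
    and st: "s \<in> gen_cross_polytope a0 \<times> {0::real}" "t \<in> gen_cross_polytope a1 \<times> {1::real}"
    and y: "y = u *\<^sub>R s + v *\<^sub>R t"
    using assms(3) by blast
  have u: "u = 1 - v" and "v \<le> 1"
    using uv by auto
  show thesis
  proof (rule that)
    show "fst s \<in> gen_cross_polytope a0" "fst t \<in> gen_cross_polytope a1"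
      using st by auto
    show "y = ((1 - v) *\<^sub>R fst s + v *\<^sub>R fst t, v)"
      using st u y by (auto simp: prod_eq_iff)
  qed (use uv \<open>v \<le> 1\<close> in auto)
qed

text \<open>Writing the last coefficient as \<open>\<beta> - \<beta>'\<close> makes the right-hand sides on the two levels
  \<open>\<beta>\<close> and \<open>\<beta>'\<close>, which treats both polytopes alike.\<close>

lemma valid_disj_hull_iff:
  fixes a0 a1 :: "real ^ 'n"
  shows "(\<forall>y\<in>disj_hull a0 a1. (\<alpha>, \<beta> - \<beta>') \<bullet> y \<le> \<beta>) \<longleftrightarrow>
     (\<forall>x\<in>gen_cross_polytope a0. \<alpha> \<bullet> x \<le> \<beta>) \<and> (\<forall>x\<in>gen_cross_polytope a1. \<alpha> \<bullet> x \<le> \<beta>')"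
proof
  assume *: "\<forall>y\<in>disj_hull a0 a1. (\<alpha>, \<beta> - \<beta>') \<bullet> y \<le> \<beta>"
  have "\<alpha> \<bullet> x \<le> \<beta>" if "x \<in> gen_cross_polytope a0" for x
    using bspec[OF * mem_disj_hullI(1)[OF that]] by simp
  moreover have "\<alpha> \<bullet> x \<le> \<beta>'" if "x \<in> gen_cross_polytope a1" for x
    using bspec[OF * mem_disj_hullI(2)[OF that]] by simp
  ultimately show "(\<forall>x\<in>gen_cross_polytope a0. \<alpha> \<bullet> x \<le> \<beta>) \<and> (\<forall>x\<in>gen_cross_polytope a1. \<alpha> \<bullet> x \<le> \<beta>')"
    by blast
next
  assume *: "(\<forall>x\<in>gen_cross_polytope a0. \<alpha> \<bullet> x \<le> \<beta>) \<and> (\<forall>x\<in>gen_cross_polytope a1. \<alpha> \<bullet> x \<le> \<beta>')"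
  have "disj_hull a0 a1 \<subseteq> {y. (\<alpha>, \<beta> - \<beta>') \<bullet> y \<le> \<beta>}"
    unfolding disj_hull_def by (rule hull_minimal) (use * in \<open>auto intro: convex_halfspace_le\<close>)
  then show "\<forall>y\<in>disj_hull a0 a1. (\<alpha>, \<beta> - \<beta>') \<bullet> y \<le> \<beta>"
    by blast
qed

lemma aff_dim_disj_hull:
  fixes a0 a1 :: "real ^ 'n"
  assumes a0: "\<And>i. a0 $ i > 0" and a1: "\<And>i. a1 $ i > 0"
  shows "aff_dim (disj_hull a0 a1) = DIM((real ^ 'n) \<times> real)"
proof (rule aff_dim_full_of_no_annihilator)
  show "0 \<in> disj_hull a0 a1"
    using mem_disj_hullI(1)[OF zero_in_gen_cross_polytope[OF a0]] by (simp add: zero_prod_def)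
  fix \<delta> :: "(real ^ 'n) \<times> real"
  assume *: "\<forall>y\<in>disj_hull a0 a1. \<delta> \<bullet> y = 0"
  obtain d m where \<delta>: "\<delta> = (d, m)"
    by fastforce
  have "d $ i = 0" for i
    using bspec[OF * mem_disj_hullI(1)[OF axis_in_gen_cross_polytope[OF a0, of 1 i]]] a0[of i]
    by (simp add: \<delta> inner_axis)
  moreover have "m = 0"
    using bspec[OF * mem_disj_hullI(2)[OF zero_in_gen_cross_polytope[OF a1]]] by (simp add: \<delta>)
  ultimately show "\<delta> = 0"
    by (simp add: \<delta> zero_prod_def vec_eq_iff)
qed simp

section \<open>Vertical facets\<close>

text \<open>The axis points attaining a bound lie on the face, and together they span the space because
  one index contributes points on both levels. The second conclusion is kept since it makes the
  inequality describing the facet unique up to scaling.\<close>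

lemma facet_describing_disj_hull:
  fixes a0 a1 :: "real ^ 'n"
  assumes a0: "\<And>i. a0 $ i > 0" and a1: "\<And>i. a1 $ i > 0" and pos: "0 < \<beta>" "0 < \<beta>'"
    and \<alpha>: "\<And>i. \<bar>\<alpha> $ i\<bar> = min (\<beta> * a0 $ i) (\<beta>' * a1 $ i)"
    and j: "\<beta> * a0 $ j = \<beta>' * a1 $ j"
  shows "facet_describing (\<alpha>, \<beta> - \<beta>') \<beta> (disj_hull a0 a1)"
    and "\<And>\<delta>. (\<forall>y \<in> disj_hull a0 a1 \<inter> {y. (\<alpha>, \<beta> - \<beta>') \<bullet> y = \<beta>}. \<delta> \<bullet> y = 0) \<Longrightarrow> \<delta> = 0"
proof -
  let ?F = "disj_hull a0 a1 \<inter> {y. (\<alpha>, \<beta> - \<beta>') \<bullet> y = \<beta>}"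
  have nz: "\<alpha> $ i \<noteq> 0" for i
    using \<alpha>[of i] mult_pos_pos[OF pos(1) a0[of i]] mult_pos_pos[OF pos(2) a1[of i]]
    by (auto simp: min_def split: if_splits)
  have sgn: "\<alpha> $ i * sgn (\<alpha> $ i) = \<bar>\<alpha> $ i\<bar>" for i
    by (simp add: abs_sgn)
  have v: "(axis i (sgn (\<alpha> $ i) / a0 $ i), 0) \<in> ?F" if "\<beta> * a0 $ i \<le> \<beta>' * a1 $ i" for i
  proof -
    have "\<alpha> $ i * sgn (\<alpha> $ i) = \<beta> * a0 $ i"
      using that by (simp add: sgn \<alpha>)
    then show ?thesis
      using a0[of i] by (auto intro!: mem_disj_hullI axis_in_gen_cross_polytope[OF a0]
          simp: inner_axis abs_sgn_eq)
  qed
  have w: "(axis i (sgn (\<alpha> $ i) / a1 $ i), 1) \<in> ?F" if "\<beta>' * a1 $ i \<le> \<beta> * a0 $ i" for i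
  proof -
    have "\<alpha> $ i * sgn (\<alpha> $ i) = \<beta>' * a1 $ i"
      using that by (simp add: sgn \<alpha>)
    then show ?thesis
      using a1[of i] by (auto intro!: mem_disj_hullI axis_in_gen_cross_polytope[OF a1]
          simp: inner_axis abs_sgn_eq)
  qed
  show ann: "\<delta> = 0" if \<delta>: "\<forall>y\<in>?F. \<delta> \<bullet> y = 0" for \<delta> :: "(real ^ 'n) \<times> real"
  proof -
    obtain d m where dm: "\<delta> = (d, m)"
      by fastforce
    have dv: "d $ i = 0" if "\<beta> * a0 $ i \<le> \<beta>' * a1 $ i" for i
      using bspec[OF \<delta> v[OF that]] nz[of i] a0[of i] by (simp add: dm inner_axis sgn_zero_iff)
    \<comment> \<open>The shared index has tight points on both levels, which forces the last component to vanish.\<close>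
    have "m = 0"
      using bspec[OF \<delta> w[of j]] dv[of j] j by (simp add: dm inner_axis)
    have "d $ i = 0" if "\<beta>' * a1 $ i \<le> \<beta> * a0 $ i" for i
      using bspec[OF \<delta> w[OF that]] nz[of i] a1[of i] \<open>m = 0\<close>
      by (simp add: dm inner_axis sgn_zero_iff)
    with dv have "d = 0"
      by (metis linear vec_eq_iff zero_index)
    with \<open>m = 0\<close> show ?thesis
      by (simp add: dm zero_prod_def)
  qed
  have "aff_dim ?F = aff_dim (disj_hull a0 a1) - 1"
    using ann pos aff_dim_hyperplane_section_iff[of ?F "(\<alpha>, \<beta> - \<beta>')" \<beta>] aff_dim_disj_hull[OF a0 a1]
    by auto
  moreover have "\<forall>y\<in>disj_hull a0 a1. (\<alpha>, \<beta> - \<beta>') \<bullet> y \<le> \<beta>"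
    unfolding valid_disj_hull_iff valid_gen_cross_polytope_iff[OF a0] valid_gen_cross_polytope_iff[OF a1]
    by (simp add: \<alpha>)
  ultimately show "facet_describing (\<alpha>, \<beta> - \<beta>') \<beta> (disj_hull a0 a1)"
    by (simp add: facet_describing_def)
qed

text \<open>A facet is a maximal proper face, so it is not contained in a different proper face. Applied to
  the faces \<open>z = 0\<close> and \<open>z = 1\<close>, this provides points of a vertical facet off either level.\<close>

lemma facet_not_subset_hyperplane_face:
  fixes S :: "'a::euclidean_space set"
  assumes F: "F facet_of S" and S: "convex S" and le: "\<And>y. y \<in> S \<Longrightarrow> c \<bullet> y \<le> b"
    and ne: "S \<inter> {y. c \<bullet> y = b} \<noteq> S" "F \<noteq> S \<inter> {y. c \<bullet> y = b}"
  obtains y where "y \<in> F" "c \<bullet> y \<noteq> b"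
proof (rule ccontr)
  let ?G = "S \<inter> {y. c \<bullet> y = b}"
  assume "\<not> thesis"
  then have sub: "F \<subseteq> ?G"
    using that facet_of_imp_subset[OF F] by blast
  have G: "?G face_of S"
    using S le by (rule face_of_Int_supporting_hyperplane_le)
  then have "F face_of ?G"
    using facet_of_imp_face_of[OF F] sub by (meson face_of_subset inf_le1)
  then have "aff_dim F < aff_dim ?G"
    using ne(2) face_of_imp_convex[OF G] S by (intro face_of_aff_dim_lt) (auto simp: convex_Int)
  moreover have "aff_dim ?G < aff_dim S"
    using S G ne(1) by (rule face_of_aff_dim_lt)
  ultimately show False
    using F by (simp add: facet_of_def)
qed

text \<open>Every vertical facet has the normal form of the preceding construction. An index
  attaining neither bound, or the absence of an index attaining both, would yield a nonzero linear
  functional vanishing on the facet, which is impossible because the facet spans the space.\<close>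

lemma vertical_facetE:
  fixes a0 a1 :: "real ^ 'n"
  assumes a0: "\<And>i. a0 $ i > 0" and a1: "\<And>i. a1 $ i > 0" and F: "vertical_facet a0 a1 F"
  obtains \<alpha> \<beta> \<beta>' j where "describes_facet (\<alpha>, \<beta> - \<beta>') \<beta> (disj_hull a0 a1) F"
    and "0 < \<beta>" "0 < \<beta>'"
    and "\<And>i. \<bar>\<alpha> $ i\<bar> = min (\<beta> * a0 $ i) (\<beta>' * a1 $ i)"
    and "\<beta> * a0 $ j = \<beta>' * a1 $ j"
    and "\<exists>x\<in>gen_cross_polytope a0. \<alpha> \<bullet> x = \<beta>" "\<exists>x\<in>gen_cross_polytope a1. \<alpha> \<bullet> x = \<beta>'"
proof -
  let ?D = "disj_hull a0 a1"
  have facet: "F facet_of ?D" and F0: "F \<noteq> ?D \<inter> {y. snd y = 0}" and F1: "F \<noteq> ?D \<inter> {y. snd y = 1}"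
    using F by (auto simp: vertical_facet_def)
  have poly: "polytope ?D"
    by (rule polytope_disj_hull[OF a0 a1])
  have conv: "convex ?D"
    by (rule polytope_imp_convex[OF poly])
  have "F exposed_face_of ?D"
    using facet_of_imp_face_of[OF facet] polytope_imp_polyhedron[OF poly]
    by (simp add: exposed_face_of_polyhedron)
  then obtain \<gamma> \<beta> where valid: "?D \<subseteq> {y. \<gamma> \<bullet> y \<le> \<beta>}" and Feq: "F = ?D \<inter> {y. \<gamma> \<bullet> y = \<beta>}"
    unfolding exposed_face_of_def by blast
  obtain \<alpha> \<mu> where "\<gamma> = (\<alpha>, \<mu>)"
    by fastforce
  define \<beta>' where "\<beta>' = \<beta> - \<mu>"
  have \<gamma>: "\<gamma> = (\<alpha>, \<beta> - \<beta>')"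
    by (simp add: \<open>\<gamma> = (\<alpha>, \<mu>)\<close> \<beta>'_def)
  have val: "\<forall>x\<in>gen_cross_polytope a0. \<alpha> \<bullet> x \<le> \<beta>" "\<forall>x\<in>gen_cross_polytope a1. \<alpha> \<bullet> x \<le> \<beta>'"
    using valid iffD1[OF valid_disj_hull_iff[of a0 a1 \<alpha> \<beta> \<beta>']] unfolding \<gamma> by auto
  then have le0: "\<bar>\<alpha> $ i\<bar> \<le> \<beta> * a0 $ i" and le1: "\<bar>\<alpha> $ i\<bar> \<le> \<beta>' * a1 $ i" for i
    using valid_gen_cross_polytope_iff[OF a0] valid_gen_cross_polytope_iff[OF a1] by blast+
  have desc: "describes_facet (\<alpha>, \<beta> - \<beta>') \<beta> ?D F"
    using facet valid Feq by (auto simp: describes_facet_def facet_describing_def facet_of_def \<gamma>)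
  \<comment> \<open>A convex combination is tight only if each end point with positive weight is tight.\<close>
  have tight: "\<exists>x0 x1 z. x0 \<in> gen_cross_polytope a0 \<and> x1 \<in> gen_cross_polytope a1 \<and>
      y = ((1 - z) *\<^sub>R x0 + z *\<^sub>R x1, z) \<and> (z = 1 \<or> \<alpha> \<bullet> x0 = \<beta>) \<and> (z = 0 \<or> \<alpha> \<bullet> x1 = \<beta>')"
    if "y \<in> F" for y
  proof -
    obtain x0 x1 z where x: "x0 \<in> gen_cross_polytope a0" "x1 \<in> gen_cross_polytope a1"
      and z: "0 \<le> z" "z \<le> 1" and y: "y = ((1 - z) *\<^sub>R x0 + z *\<^sub>R x1, z)"
      using mem_disj_hullE[OF a0 a1] \<open>y \<in> F\<close> Feq by blast
    have "(1 - z) * (\<beta> - \<alpha> \<bullet> x0) + z * (\<beta>' - \<alpha> \<bullet> x1) = \<beta> - \<gamma> \<bullet> y"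
      by (simp add: \<gamma> y inner_add_right algebra_simps)
    also have "\<dots> = 0"
      using \<open>y \<in> F\<close> Feq by simp
    finally have "(1 - z) * (\<beta> - \<alpha> \<bullet> x0) + z * (\<beta>' - \<alpha> \<bullet> x1) = 0" .
    moreover have "0 \<le> (1 - z) * (\<beta> - \<alpha> \<bullet> x0)" "0 \<le> z * (\<beta>' - \<alpha> \<bullet> x1)"
      using val x z by auto
    ultimately have "(1 - z) * (\<beta> - \<alpha> \<bullet> x0) = 0" "z * (\<beta>' - \<alpha> \<bullet> x1) = 0"
      by linarith+
    with x y show ?thesis
      by auto
  qed
  have z01: "0 \<le> snd y \<and> snd y \<le> 1" if "y \<in> ?D" for y
    using mem_disj_hullE[OF a0 a1 that] by (metis snd_conv)
  have pt0: "(0, 0) \<in> ?D" and pt1: "(0, 1) \<in> ?D"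
    using mem_disj_hullI zero_in_gen_cross_polytope[OF a0] zero_in_gen_cross_polytope[OF a1] by auto
  have ex0: "\<exists>x\<in>gen_cross_polytope a0. \<alpha> \<bullet> x = \<beta>"
  proof -
    have level: "?D \<inter> {y. (0, 1) \<bullet> y = 1} = ?D \<inter> {y. snd y = 1}"
      by (auto simp: inner_prod_def)
    have "?D \<inter> {y. (0, 1) \<bullet> y = 1} \<noteq> ?D"
      using pt0 by force
    then obtain y where y: "y \<in> F" "(0, 1) \<bullet> y \<noteq> 1"
      using F1 level z01 by (elim facet_not_subset_hyperplane_face[OF facet conv, rotated])
        (auto simp: inner_prod_def)
    with tight[OF y(1)] show ?thesis
      by (auto simp: inner_prod_def)
  qed
  have ex1: "\<exists>x\<in>gen_cross_polytope a1. \<alpha> \<bullet> x = \<beta>'"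
  proof -
    have level: "?D \<inter> {y. (0, - 1) \<bullet> y = 0} = ?D \<inter> {y. snd y = 0}"
      by (auto simp: inner_prod_def)
    have "?D \<inter> {y. (0, - 1) \<bullet> y = 0} \<noteq> ?D"
      using pt1 by force
    then obtain y where y: "y \<in> F" "(0, - 1) \<bullet> y \<noteq> 0"
      using F0 level z01 by (elim facet_not_subset_hyperplane_face[OF facet conv, rotated])
        (auto simp: inner_prod_def)
    with tight[OF y(1)] show ?thesis
      by (auto simp: inner_prod_def)
  qed
  have ge0: "\<beta> \<ge> 0" "\<beta>' \<ge> 0"
    using val zero_in_gen_cross_polytope[OF a0] zero_in_gen_cross_polytope[OF a1] by force+
  have "\<alpha> \<noteq> 0"
  proof
    assume "\<alpha> = 0"
    then have "\<gamma> = 0" "\<beta> = 0"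
      using ex0 ex1 by (auto simp: \<gamma> zero_prod_def)
    then have "F = ?D"
      using Feq by auto
    with facet show False
      by simp
  qed
  then obtain k where "\<alpha> $ k \<noteq> 0"
    by (auto simp: vec_eq_iff)
  then have "\<beta> \<noteq> 0" "\<beta>' \<noteq> 0"
    using le0[of k] le1[of k] by auto
  with ge0 have pos: "0 < \<beta>" "0 < \<beta>'"
    by auto
  have ann: "\<delta> = 0" if "\<forall>y\<in>F. \<delta> \<bullet> y = 0" for \<delta> :: "(real ^ 'n) \<times> real"
  proof -
    have "aff_dim F = DIM((real ^ 'n) \<times> real) - 1"
      using facet aff_dim_disj_hull[OF a0 a1] by (simp add: facet_of_def)
    moreover have "F \<subseteq> {y. \<gamma> \<bullet> y = \<beta>}"
      using Feq by blast
    ultimately show ?thesis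
      using aff_dim_hyperplane_section_iff[of F \<gamma> \<beta>] \<open>\<beta> \<noteq> 0\<close> that by blast
  qed
  have zero0: "x $ i = 0" if "x \<in> gen_cross_polytope a0" "\<alpha> \<bullet> x = \<beta>" "\<bar>\<alpha> $ i\<bar> \<noteq> \<beta> * a0 $ i" for x i
    using tight_point_coordinate_zero[OF a0 le0 that(1,2)] that(3) le0[of i] by simp
  have zero1: "x $ i = 0" if "x \<in> gen_cross_polytope a1" "\<alpha> \<bullet> x = \<beta>'" "\<bar>\<alpha> $ i\<bar> \<noteq> \<beta>' * a1 $ i" for x i
    using tight_point_coordinate_zero[OF a1 le1 that(1,2)] that(3) le1[of i] by simp
  \<comment> \<open>If both bounds on \<open>\<alpha>\<^sub>i\<close> were strict, the facet would satisfy \<open>x\<^sub>i = 0\<close>.\<close>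
  have some: "\<bar>\<alpha> $ i\<bar> = \<beta> * a0 $ i \<or> \<bar>\<alpha> $ i\<bar> = \<beta>' * a1 $ i" for i
  proof (rule ccontr)
    assume no: "\<not> ?thesis"
    have "\<forall>y\<in>F. (axis i 1, 0) \<bullet> y = 0"
    proof
      fix y
      assume "y \<in> F"
      from tight[OF this] obtain x0 x1 z where "x0 \<in> gen_cross_polytope a0"
        "x1 \<in> gen_cross_polytope a1" "y = ((1 - z) *\<^sub>R x0 + z *\<^sub>R x1, z)"
        "z = 1 \<or> \<alpha> \<bullet> x0 = \<beta>" "z = 0 \<or> \<alpha> \<bullet> x1 = \<beta>'"
        by blast
      with no zero0[of x0 i] zero1[of x1 i] show "(axis i 1, 0) \<bullet> y = 0"
        by (auto simp: inner_axis')
    qed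
    then have "(axis i (1::real), 0::real) = 0"
      by (rule ann)
    then show False
      by (simp add: zero_prod_def)
  qed
  \<comment> \<open>If no index met both bounds, let \<open>d\<close> be the part of \<open>\<alpha>\<close> that is tight for the upper level. Then
    \<open>d \<bullet> x = \<beta>' z\<close> on tight points of either level, hence on the whole facet.\<close>
  have "\<exists>j. \<beta> * a0 $ j = \<beta>' * a1 $ j"
  proof (rule ccontr)
    assume "\<not> ?thesis"
    then have no: "\<beta> * a0 $ i \<noteq> \<beta>' * a1 $ i" for i
      by blast
    define d where "d = (\<chi> i. if \<bar>\<alpha> $ i\<bar> = \<beta>' * a1 $ i then \<alpha> $ i else 0)"
    have d0: "d \<bullet> x = 0" if "x \<in> gen_cross_polytope a0" "\<alpha> \<bullet> x = \<beta>" for x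
    proof -
      have "d $ i * x $ i = 0" for i
        using zero0[OF that, of i] no[of i] by (auto simp: d_def)
      then show ?thesis
        unfolding inner_vec_def by (intro sum.neutral) auto
    qed
    have d1: "d \<bullet> x = \<beta>'" if "x \<in> gen_cross_polytope a1" "\<alpha> \<bullet> x = \<beta>'" for x
    proof -
      have "d $ i * x $ i = \<alpha> $ i * x $ i" for i
        using zero1[OF that, of i] by (auto simp: d_def)
      then have "d \<bullet> x = \<alpha> \<bullet> x"
        unfolding inner_vec_def by (intro sum.cong) auto
      with that show ?thesis
        by simp
    qed
    have "\<forall>y\<in>F. (d, - \<beta>') \<bullet> y = 0"
    proof
      fix y
      assume "y \<in> F"
      from tight[OF this] obtain x0 x1 z where "x0 \<in> gen_cross_polytope a0"
        "x1 \<in> gen_cross_polytope a1" "y = ((1 - z) *\<^sub>R x0 + z *\<^sub>R x1, z)"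
        "z = 1 \<or> \<alpha> \<bullet> x0 = \<beta>" "z = 0 \<or> \<alpha> \<bullet> x1 = \<beta>'"
        by blast
      with d0[of x0] d1[of x1] show "(d, - \<beta>') \<bullet> y = 0"
        by (auto simp: inner_add_right algebra_simps)
    qed
    then have "(d, - \<beta>') = 0"
      by (rule ann)
    with \<open>\<beta>' \<noteq> 0\<close> show False
      by (simp add: zero_prod_def)
  qed
  then obtain j where "\<beta> * a0 $ j = \<beta>' * a1 $ j" ..
  moreover have "\<bar>\<alpha> $ i\<bar> = min (\<beta> * a0 $ i) (\<beta>' * a1 $ i)" for i
    using some[of i] le0[of i] le1[of i] by (auto simp: min_def)
  ultimately show thesis
    using that desc pos ex0 ex1 by blast
qed

section \<open>Optimal liftings and the ratio set\<close>

text \<open>Having at most two elements means that each element is a maximum or a minimum, the form in which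
  the ratios enter the analysis of facets.\<close>

lemma card_le_2_iff_no_middle:
  fixes R :: "'a::linorder set"
  assumes "finite R"
  shows "card R \<le> 2 \<longleftrightarrow> (\<forall>t\<in>R. (\<forall>r\<in>R. r \<le> t) \<or> (\<forall>r\<in>R. t \<le> r))"
proof
  assume c: "card R \<le> 2"
  show "\<forall>t\<in>R. (\<forall>r\<in>R. r \<le> t) \<or> (\<forall>r\<in>R. t \<le> r)"
  proof (rule ccontr)
    assume "\<not> ?thesis"
    then obtain t r s where t: "t \<in> R" "r \<in> R" "s \<in> R" "r < t" "t < s"
      by (auto simp: not_le)
    then have "r \<noteq> t" "r \<noteq> s" "t \<noteq> s"
      by auto
    then have "card {r, t, s} = 3"
      by simp
    moreover have "card {r, t, s} \<le> card R"
      using t assms by (intro card_mono) auto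
    ultimately show False
      using c by simp
  qed
next
  assume *: "\<forall>t\<in>R. (\<forall>r\<in>R. r \<le> t) \<or> (\<forall>r\<in>R. t \<le> r)"
  show "card R \<le> 2"
  proof (cases "R = {}")
    case False
    have "R \<subseteq> {Min R, Max R}"
    proof
      fix t
      assume "t \<in> R"
      with * assms False show "t \<in> {Min R, Max R}"
        by (metis Max_eqI Min_eqI insert_iff)
    qed
    then have "card R \<le> card {Min R, Max R}"
      by (intro card_mono) auto
    also have "\<dots> \<le> 2"
      by (simp add: card_insert_if)
    finally show ?thesis .
  qed simp
qed

text \<open>A vertical facet belongs to the ratio \<open>\<beta>' / \<beta>\<close> at \<open>j\<close>. If this is the largest ratio, the minimum
  in the normal form is always \<open>\<beta> a0\<^sub>i\<close>, a facet normal of the lower polytope; if it is the smallest,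
  the minimum is \<open>\<beta>' a1\<^sub>i\<close>. Since the facet is tight on both levels, the optimal big-M coefficient
  is the actual one.\<close>

lemma vertical_facet_lifted_of_extreme_ratio:
  fixes a0 a1 :: "real ^ 'n"
  assumes a0: "\<And>i. a0 $ i > 0" and a1: "\<And>i. a1 $ i > 0"
    and ext: "\<And>j. (\<forall>i. a0 $ i / a1 $ i \<le> a0 $ j / a1 $ j) \<or> (\<forall>i. a0 $ j / a1 $ j \<le> a0 $ i / a1 $ i)"
    and F: "vertical_facet a0 a1 F"
  shows "\<exists>\<gamma> \<beta>. optimal_big_M_lifting a0 a1 \<gamma> \<beta> \<and> describes_facet \<gamma> \<beta> (disj_hull a0 a1) F"
proof -
  obtain \<alpha> \<beta> \<beta>' j where desc: "describes_facet (\<alpha>, \<beta> - \<beta>') \<beta> (disj_hull a0 a1) F"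
    and pos: "0 < \<beta>" "0 < \<beta>'"
    and \<alpha>: "\<And>i. \<bar>\<alpha> $ i\<bar> = min (\<beta> * a0 $ i) (\<beta>' * a1 $ i)"
    and j: "\<beta> * a0 $ j = \<beta>' * a1 $ j"
    and ex0: "\<exists>x\<in>gen_cross_polytope a0. \<alpha> \<bullet> x = \<beta>"
    and ex1: "\<exists>x\<in>gen_cross_polytope a1. \<alpha> \<bullet> x = \<beta>'"
    by (rule vertical_facetE[OF a0 a1 F]) (rule that; assumption)
  have val0: "\<forall>x\<in>gen_cross_polytope a0. \<alpha> \<bullet> x \<le> \<beta>" and val1: "\<forall>x\<in>gen_cross_polytope a1. \<alpha> \<bullet> x \<le> \<beta>'"
    by (simp_all add: valid_gen_cross_polytope_iff a0 a1 \<alpha>)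
  have ratio: "a0 $ j / a1 $ j = \<beta>' / \<beta>"
    using j a1[of j] pos by (simp add: field_simps)
  from ext[of j] show ?thesis
  proof
    assume "\<forall>i. a0 $ i / a1 $ i \<le> a0 $ j / a1 $ j"
    then have "a0 $ i / a1 $ i \<le> \<beta>' / \<beta>" for i
      unfolding ratio by blast
    then have "\<beta> * a0 $ i \<le> \<beta>' * a1 $ i" for i
      using a1 pos by (simp add: pos_divide_le_eq pos_le_divide_eq mult.commute)
    then have "facet_describing \<alpha> \<beta> (gen_cross_polytope a0)"
      using pos by (simp add: facet_describing_gen_cross_polytope_iff a0 \<alpha>)
    moreover have "big_M (gen_cross_polytope a1) \<alpha> \<beta> = \<beta> - \<beta>'"
      using ex1 val1 big_M_eq[of "gen_cross_polytope a1"] by blast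
    ultimately have "optimal_big_M_lifting a0 a1 (\<alpha>, \<beta> - \<beta>') \<beta>"
      by (intro optimal_big_M_lifting.from_0) auto
    with desc show ?thesis
      by blast
  next
    assume "\<forall>i. a0 $ j / a1 $ j \<le> a0 $ i / a1 $ i"
    then have "\<beta>' / \<beta> \<le> a0 $ i / a1 $ i" for i
      unfolding ratio by blast
    then have "\<beta>' * a1 $ i \<le> \<beta> * a0 $ i" for i
      using a1 pos by (simp add: pos_divide_le_eq pos_le_divide_eq mult.commute)
    then have "facet_describing \<alpha> \<beta>' (gen_cross_polytope a1)"
      using pos by (simp add: facet_describing_gen_cross_polytope_iff a1 \<alpha> min_absorb2)
    moreover have "big_M (gen_cross_polytope a0) \<alpha> \<beta>' = \<beta>' - \<beta>"
      using ex0 val0 big_M_eq[of "gen_cross_polytope a0"] by blast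
    ultimately have "optimal_big_M_lifting a0 a1 (\<alpha>, - (\<beta>' - \<beta>)) (\<beta>' - (\<beta>' - \<beta>))"
      by (intro optimal_big_M_lifting.from_1) auto
    then have "optimal_big_M_lifting a0 a1 (\<alpha>, \<beta> - \<beta>') \<beta>"
      by simp
    with desc show ?thesis
      by blast
  qed
qed

text \<open>The normal form with \<open>t = r\<^sub>j\<close> follows \<open>a0\<close> on \<open>i\<close> and \<open>t a1\<close> on \<open>k\<close>, so it is proportional neither
  to \<open>a0\<close> nor to \<open>a1\<close>, while lifting leaves the coefficients of \<open>x\<close> unchanged.\<close>

lemma intermediate_ratio_unlifted_facet:
  fixes a0 a1 :: "real ^ 'n"
  assumes a0: "\<And>i. a0 $ i > 0" and a1: "\<And>i. a1 $ i > 0"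
    and r: "a0 $ i / a1 $ i < a0 $ j / a1 $ j" "a0 $ j / a1 $ j < a0 $ k / a1 $ k"
  shows "\<exists>F. vertical_facet a0 a1 F \<and>
    \<not> (\<exists>\<gamma> \<beta>. optimal_big_M_lifting a0 a1 \<gamma> \<beta> \<and> describes_facet \<gamma> \<beta> (disj_hull a0 a1) F)"
proof -
  let ?D = "disj_hull a0 a1"
  define t where "t = a0 $ j / a1 $ j"
  define \<alpha> :: "real ^ 'n" where "\<alpha> = (\<chi> l. min (a0 $ l) (t * a1 $ l))"
  define F where "F = ?D \<inter> {y. (\<alpha>, 1 - t) \<bullet> y = 1}"
  have t: "0 < t" "a0 $ j = t * a1 $ j"
    using a0[of j] a1[of j] by (auto simp: t_def)
  have i: "a0 $ i < t * a1 $ i" and k: "t * a1 $ k < a0 $ k"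
    using r a1[of i] a1[of k] by (auto simp: t_def[symmetric] field_simps)
  have abs: "\<bar>\<alpha> $ l\<bar> = min (1 * a0 $ l) (t * a1 $ l)" for l
    using a0[of l] a1[of l] t by (simp add: \<alpha>_def)
  have \<alpha>i: "\<alpha> $ i = a0 $ i" and \<alpha>k: "\<alpha> $ k = t * a1 $ k"
    using i k by (auto simp: \<alpha>_def)
  have \<alpha>j: "\<alpha> $ j = a0 $ j"
    using t by (simp add: \<alpha>_def)
  have desc: "facet_describing (\<alpha>, 1 - t) 1 ?D"
    and ann: "\<And>\<delta>. (\<forall>y\<in>F. \<delta> \<bullet> y = 0) \<Longrightarrow> \<delta> = 0"
    unfolding F_def using facet_describing_disj_hull[OF a0 a1 _ t(1) abs, of j] t(2) by auto
  have v: "(axis j (1 / a0 $ j), 0) \<in> F"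
    using a0[of j] by (auto simp: F_def inner_axis \<alpha>j intro!: mem_disj_hullI axis_in_gen_cross_polytope a0)
  have w: "(axis j (1 / a1 $ j), 1) \<in> F"
    using a1[of j] t(2)
    by (auto simp: F_def inner_axis \<alpha>j intro!: mem_disj_hullI axis_in_gen_cross_polytope a1)
  have "F face_of ?D"
    using desc polytope_imp_convex[OF polytope_disj_hull[OF a0 a1]] unfolding F_def
    by (intro face_of_Int_supporting_hyperplane_le) (auto simp: facet_describing_def)
  then have "F facet_of ?D"
    using desc v by (auto simp: facet_of_def facet_describing_def F_def)
  moreover have "F \<noteq> ?D \<inter> {y. snd y = 0}" "F \<noteq> ?D \<inter> {y. snd y = 1}"
    using v w by (metis (mono_tags) Int_iff mem_Collect_eq snd_conv zero_neq_one)+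
  ultimately have vert: "vertical_facet a0 a1 F"
    by (simp add: vertical_facet_def)
  have False if opt: "optimal_big_M_lifting a0 a1 \<gamma> \<beta>" and "describes_facet \<gamma> \<beta> ?D F" for \<gamma> \<beta>
  proof -
    have eq: "\<gamma> \<bullet> y = \<beta>" if "y \<in> F" for y
      using \<open>describes_facet \<gamma> \<beta> ?D F\<close> that by (auto simp: describes_facet_def)
    \<comment> \<open>The facet spans the space, so the inequality defining it is unique up to scaling.\<close>
    have "\<gamma> - \<beta> *\<^sub>R (\<alpha>, 1 - t) = 0"
    proof (rule ann, rule ballI)
      fix y
      assume "y \<in> F"
      then have "(\<alpha>, 1 - t) \<bullet> y = 1"
        by (simp add: F_def)
      with eq[OF \<open>y \<in> F\<close>] show "(\<gamma> - \<beta> *\<^sub>R (\<alpha>, 1 - t)) \<bullet> y = 0"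
        by (simp only: inner_diff_left inner_scaleR_left)
    qed
    then have fst: "fst \<gamma> = \<beta> *\<^sub>R \<alpha>"
      by (simp add: prod_eq_iff)
    from opt show False
    proof cases
      case (from_0 \<alpha>' M1)
      then have "\<bar>\<beta> * \<alpha> $ l\<bar> = \<beta> * a0 $ l" and "0 < \<beta>" for l
        using fst by (auto simp: facet_describing_gen_cross_polytope_iff a0)
      \<comment> \<open>At \<open>k\<close> the normal is strictly below \<open>a0\<close>, although it has the same scale \<open>\<beta>\<close>.\<close>
      from this(1)[of k] this(2) show False
        using \<alpha>k k a1[of k] t(1) by (simp add: abs_mult)
    next
      case (from_1 \<alpha>' \<beta>' M0)
      then have "\<alpha>' = \<beta> *\<^sub>R \<alpha>"
        using fst by simp
      with from_1 have *: "\<bar>\<beta> * \<alpha> $ l\<bar> = \<beta>' * a1 $ l" for l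
        unfolding facet_describing_gen_cross_polytope_iff[OF a1]
        by (metis vector_scaleR_component real_scaleR_def)
      \<comment> \<open>At \<open>i\<close> and \<open>j\<close> the normal agrees with \<open>a0\<close>, but the ratios there differ, so it cannot be
        proportional to \<open>a1\<close>.\<close>
      have "\<beta>' = \<bar>\<beta>\<bar> * t"
        using *[of j] \<alpha>j t a1[of j] by (simp add: abs_mult)
      moreover have "\<bar>\<beta>\<bar> * a0 $ i = \<beta>' * a1 $ i"
        using *[of i] \<alpha>i a0[of i] by (simp add: abs_mult)
      ultimately have "\<bar>\<beta>\<bar> * (t * a1 $ i - a0 $ i) = 0"
        by (auto simp: algebra_simps)
      then have "\<beta> = 0"
        using i by auto
      with \<open>\<beta>' = \<bar>\<beta>\<bar> * t\<close> from_1 show False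
        by (simp add: facet_describing_gen_cross_polytope_iff a1)
    qed
  qed
  with vert show ?thesis
    by blast
qed

theorem theorem14:
  fixes a0 a1 :: "real ^ 'n"
  assumes "\<And>i. a0 $ i > 0" and "\<And>i. a1 $ i > 0"
  shows "(\<forall>F. vertical_facet a0 a1 F \<longrightarrow>
            (\<exists>\<gamma> \<beta>. optimal_big_M_lifting a0 a1 \<gamma> \<beta> \<and>
                    describes_facet \<gamma> \<beta> (disj_hull a0 a1) F))
         \<longleftrightarrow> card (range (\<lambda>i. a0 $ i / a1 $ i)) \<le> 2"
proof -
  have "card (range (\<lambda>i. a0 $ i / a1 $ i)) \<le> 2 \<longleftrightarrow>
    (\<forall>j. (\<forall>i. a0 $ i / a1 $ i \<le> a0 $ j / a1 $ j) \<or> (\<forall>i. a0 $ j / a1 $ j \<le> a0 $ i / a1 $ i))"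
    by (simp add: card_le_2_iff_no_middle)
  moreover have "(\<exists>F. vertical_facet a0 a1 F \<and>
      \<not> (\<exists>\<gamma> \<beta>. optimal_big_M_lifting a0 a1 \<gamma> \<beta> \<and> describes_facet \<gamma> \<beta> (disj_hull a0 a1) F))"
    if "\<not> (\<forall>j. (\<forall>i. a0 $ i / a1 $ i \<le> a0 $ j / a1 $ j) \<or> (\<forall>i. a0 $ j / a1 $ j \<le> a0 $ i / a1 $ i))"
  proof -
    from that obtain i j k
      where "a0 $ i / a1 $ i < a0 $ j / a1 $ j" "a0 $ j / a1 $ j < a0 $ k / a1 $ k"
      unfolding not_all de_Morgan_disj not_le by blast
    then show ?thesis
      by (rule intermediate_ratio_unlifted_facet[OF assms])
  qed
  ultimately show ?thesis
    using vertical_facet_lifted_of_extreme_ratio[OF assms] by blast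
qed

end
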